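(* Let $R$ be a commutative ring with unity, let $U(R)$ be its set of units, and let $\Gamma'^{c}(R)$ be the complement unity product graph associated with $R$. If $|U(R)|>3$, then $gr(\Gamma'^{c}(R))=3$.
   Context: For a ring $R$ with unity $e$ and set of units $U(R)$, the complement unity product graph $\Gamma'^{c}(R)$ is the simple graph with vertex set $U(R)$ in which two distinct vertices $r_i,r_j$ are adjacent if and only if $r_i\cdot r_j\neq e$. The girth $gr(\Gamma)$ of a graph $\Gamma$ is the length of a shortest cycle contained in $\Gamma$, with $gr(\Gamma)=\infty$ if $\Gamma$ contains no cycle. *)

theory Defs
  imports
    "HOL-Algebra.Ring"
    "HOL-Library.Extended_Nat"
    "Graph_Theory.Pair_Digraph"
begin

text \<open>
  A simple graph, possibly infinite, is a loop-free symmetric digraph without parallel arcs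
  (locale \<^locale>\<open>pair_bidirected_digraph\<close>): the edge between \<open>u\<close> and \<open>v\<close> is represented by the
  two arcs \<open>(u, v)\<close> and \<open>(v, u)\<close>.
\<close>

definition complement_unity_product_graph :: "('a, 'b) ring_scheme \<Rightarrow> 'a pair_pre_digraph" where
  "complement_unity_product_graph R =
     \<lparr> pverts = Units R,
       parcs = {(r, s). r \<in> Units R \<and> s \<in> Units R \<and> r \<noteq> s \<and> r \<otimes>\<^bsub>R\<^esub> s \<noteq> \<one>\<^bsub>R\<^esub>} \<rparr>"

text \<open>
  The adjacency condition is symmetric in the two units, also over a noncommutative ring, so this
  is a simple graph.
\<close>

lemma pair_bidirected_digraph_complement_unity_product_graph:
  assumes "ring R"
  shows "pair_bidirected_digraph (complement_unity_product_graph R)"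
proof -
  interpret ring R by fact
  have comm: "s \<otimes>\<^bsub>R\<^esub> r = \<one>\<^bsub>R\<^esub>"
    if "r \<in> Units R" "s \<in> Units R" "r \<otimes>\<^bsub>R\<^esub> s = \<one>\<^bsub>R\<^esub>" for r s
  proof -
    have "inv\<^bsub>R\<^esub> r = s"
      using inv_unique[of "inv\<^bsub>R\<^esub> r" r s] Units_closed that by simp
    with that show ?thesis by auto
  qed
  show ?thesis
    by unfold_locales
      (auto simp: complement_unity_product_graph_def symmetric_def sym_def dest: comm)
qed

text \<open>
  The library's cycles are closed arc walks of positive length with pairwise distinct vertices,
  including the walks \<open>u, v, u\<close> that traverse one edge back and forth. The latter are not cycles
  of a simple graph, whence the bound on the length.
\<close>

definition simple_cycle :: "'a pair_pre_digraph \<Rightarrow> ('a \<times> 'a) awalk \<Rightarrow> bool" where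
  "simple_cycle G p \<longleftrightarrow> pre_digraph.cycle (with_proj G) p \<and> length p \<ge> 3"

definition girth :: "'a pair_pre_digraph \<Rightarrow> enat" where
  "girth G = (INF p \<in> {p. simple_cycle G p}. enat (length p))"

lemma girth_acyclic: "girth G = \<infinity> \<longleftrightarrow> \<not> (\<exists>p. simple_cycle G p)"
  by (simp add: girth_def INF_top_conv(1) flip: top_enat_def) (simp add: top_enat_def)

end

theory Submission
  imports Defs
begin

text \<open>
  A cycle has length at least three, so it suffices to exhibit a triangle. The unity \<open>e\<close> is
  adjacent to every other unit \<open>a\<close>, because \<open>e \<cdot> a = a \<noteq> e\<close>. Fix a unit \<open>a \<noteq> e\<close>. Its only
  possible non-neighbour among the other units is its inverse, and since there are more than three
  units, some unit \<open>b\<close> avoids \<open>e\<close>, \<open>a\<close> and the inverse of \<open>a\<close>. Then \<open>e, a, b\<close> is a triangle.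
\<close>

lemma girth_eq_3_if_triangle:
  assumes vert: "u \<in> pverts G"
    and distinct: "u \<noteq> v" "v \<noteq> w" "w \<noteq> u"
    and arcs: "(u, v) \<in> parcs G" "(v, w) \<in> parcs G" "(w, u) \<in> parcs G"
  shows "girth G = 3"
proof -
  let ?p = "[(u, v), (v, w), (w, u)]"
  have "simple_cycle G ?p"
    using assms
    by (auto simp: simple_cycle_def pre_digraph.cycle_def pre_digraph.awalk_def
        pre_digraph.cas.simps pre_digraph.awalk_verts.simps)
  then have "girth G \<le> enat (length ?p)"
    unfolding girth_def by (intro INF_lower) simp
  moreover have "3 \<le> girth G"
    unfolding girth_def by (intro INF_greatest) (simp add: simple_cycle_def numeral_eq_enat)
  ultimately show ?thesis
    by (simp add: numeral_eq_enat eval_nat_numeral)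
qed

lemma obtain_outside_finite:
  assumes "finite B" "infinite A \<or> card B < card A"
  obtains x where "x \<in> A" "x \<notin> B"
proof -
  have "\<not> A \<subseteq> B"
    using assms card_mono[of B A] finite_subset[of A B] by auto
  then show thesis
    using that by blast
qed

theorem theorem4p3:
  fixes R :: "('a, 'b) ring_scheme"
  assumes "cring R"
    and "infinite (Units R) \<or> card (Units R) > 3"
  shows "girth (complement_unity_product_graph R) = 3"
proof -
  interpret cring R by fact
  have "infinite (Units R) \<or> card {\<one>\<^bsub>R\<^esub>} < card (Units R)"
    using assms(2) by auto
  then obtain a where a: "a \<in> Units R" "a \<noteq> \<one>\<^bsub>R\<^esub>"
    using obtain_outside_finite[of "{\<one>\<^bsub>R\<^esub>}" "Units R"] by blast
  \<comment> \<open>Only an upper bound: \<open>a\<close> may be its own inverse.\<close>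
  have "card {\<one>\<^bsub>R\<^esub>, a, inv\<^bsub>R\<^esub> a} \<le> 3"
    by (simp add: card_insert_if)
  then have "infinite (Units R) \<or> card {\<one>\<^bsub>R\<^esub>, a, inv\<^bsub>R\<^esub> a} < card (Units R)"
    using assms(2) by linarith
  then obtain b where b: "b \<in> Units R" "b \<noteq> \<one>\<^bsub>R\<^esub>" "b \<noteq> a" "b \<noteq> inv\<^bsub>R\<^esub> a"
    using obtain_outside_finite[of "{\<one>\<^bsub>R\<^esub>, a, inv\<^bsub>R\<^esub> a}" "Units R"] by blast
  have "a \<otimes>\<^bsub>R\<^esub> b \<noteq> \<one>\<^bsub>R\<^esub>"
    using a(1) b(1,4) comm_inv_char[of a b] by auto
  with a b show ?thesis
    by (intro girth_eq_3_if_triangle[of "\<one>\<^bsub>R\<^esub>" _ a b])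
      (auto simp: complement_unity_product_graph_def)
qed

end
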